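(* Consider a $k$-CS-PIP instance in which $s_{ij}\le c_j$ for all $i,j$, rescaled so that for every constraint $j$, $\max_{i: s_{ij}>0}s_{ij}=1$; then $B:=\min_j c_j\ge1$ equals the slack. Set $\alpha:=4e(\lfloor B\rfloor k)^{1/\lfloor B\rfloor}$ and let $x$ be an optimal solution of the natural LP relaxation. Put each item $i$ in $\mathcal{S}$ independently with probability $x_i/\alpha$. For each item $i$ and constraint $j$ with $s_{ij}>0$, let $t_{ij}$ be the smallest number of the form $2^{-a}$, $a\in\mathbb{Z}_{\ge0}$, with $t_{ij}\ge s_{ij}$; let $E_{ij}$ be the event that the items $\{i'\in\mathcal{S}\mid t_{i'j}\ge t_{ij}\}$ have total $t$-size $\sum t_{i'j}$ exceeding $c_j$. Let $\mathcal{S}'$ be the set of $i\in\mathcal{S}$ for which no $E_{ij}$ occurs (over $j$ with $s_{ij}>0$). Then for each item $i$ (with $x_i>0$), $\Pr[i\in\mathcal{S}'\mid i\in\mathcal{S}]\ge\left(1-\frac{1}{k\lfloor B\rfloor}\right)^k$.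
   Context: $k$-CS-PIP: maximize $w^Tx$ subject to $Sx\le c$, $x\in\{0,1\}^n$, with $w\in\mathbb{R}^n_+$, $c\in\mathbb{R}^m_+$, $S=(s_{ij})\in\mathbb{R}_+^{m\times n}$ having at most $k$ nonzero entries per column. The slack is $\min\{c_j/s_{ij}: s_{ij}>0\}$. The natural LP relaxation replaces $x\in\{0,1\}^n$ by $x\in[0,1]^n$. *)

theory Defs
  imports "HOL-Probability.Probability"
begin

text \<open>
  The matrix \<open>S\<close> has one row per constraint and one column per item, so the size \<open>s\<^sub>i\<^sub>j\<close> of item
  \<open>i\<close> in constraint \<open>j\<close> is \<open>S $ j $ i\<close>. Inequalities between vectors are componentwise.
\<close>

definition k_cs_pip :: "nat \<Rightarrow> real^'n \<Rightarrow> real^'n^'m \<Rightarrow> real^'m \<Rightarrow> bool" where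
  "k_cs_pip k w S c \<longleftrightarrow>
     0 \<le> w \<and> 0 \<le> c \<and> (\<forall>j i. 0 \<le> S $ j $ i) \<and> (\<forall>i. card {j. S $ j $ i \<noteq> 0} \<le> k)"

definition slack :: "real^'n^'m \<Rightarrow> real^'m \<Rightarrow> real" where
  "slack S c = Min {c $ j / S $ j $ i | i j. S $ j $ i > 0}"

text \<open>
  Nonemptiness is required explicitly because the value of \<open>Max {}\<close> is unspecified.
\<close>

definition rescaled :: "real^'n^'m \<Rightarrow> bool" where
  "rescaled S \<longleftrightarrow>
     (\<forall>j. {S $ j $ i | i. S $ j $ i > 0} \<noteq> {} \<and> Max {S $ j $ i | i. S $ j $ i > 0} = 1)"

definition lp_feasible :: "real^'n^'m \<Rightarrow> real^'m \<Rightarrow> real^'n \<Rightarrow> bool" where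
  "lp_feasible S c x \<longleftrightarrow> S *v x \<le> c \<and> (\<forall>i. 0 \<le> x $ i \<and> x $ i \<le> 1)"

definition lp_optimal :: "real^'n \<Rightarrow> real^'n^'m \<Rightarrow> real^'m \<Rightarrow> real^'n \<Rightarrow> bool" where
  "lp_optimal w S c x \<longleftrightarrow> is_arg_max (\<lambda>y. w \<bullet> y) (lp_feasible S c) x"

text \<open>
  The number \<open>t\<^sub>i\<^sub>j\<close> is \<open>pow2_ceil (S $ j $ i)\<close>. It is meaningful only for arguments in \<open>(0, 1]\<close>;
  outside that range the minimum does not exist.
\<close>

definition pow2_ceil :: "real \<Rightarrow> real" where
  "pow2_ceil s = (LEAST t. (\<exists>a::nat. t = 1 / 2 ^ a) \<and> s \<le> t)"

text \<open>
  \<open>overflow S c A i j\<close> is the event \<open>E\<^sub>i\<^sub>j\<close> when the sampled set is \<open>A\<close>. Items that do not occur in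
  constraint \<open>j\<close> have no \<open>t\<close>-size there and are left out of the sum.
\<close>

definition overflow :: "real^'n^'m \<Rightarrow> real^'m \<Rightarrow> 'n set \<Rightarrow> 'n \<Rightarrow> 'm \<Rightarrow> bool" where
  "overflow S c A i j \<longleftrightarrow>
     (\<Sum>i' \<in> {i' \<in> A. S $ j $ i' > 0 \<and> pow2_ceil (S $ j $ i') \<ge> pow2_ceil (S $ j $ i)}.
        pow2_ceil (S $ j $ i')) > c $ j"

definition altered :: "real^'n^'m \<Rightarrow> real^'m \<Rightarrow> 'n set \<Rightarrow> 'n set" where
  "altered S c A = {i \<in> A. \<forall>j. S $ j $ i > 0 \<longrightarrow> \<not> overflow S c A i j}"

end

theory Submission
  imports Defs
begin

text \<open>
  Condition on \<open>i \<in> \<S>\<close>. The event that \<open>E\<^sub>i\<^sub>j\<close> does not occur is decreasing in the remaining sampled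
  items, so by the Harris inequality the probability that none of the at most \<open>k\<close> events \<open>E\<^sub>i\<^sub>j\<close>
  occurs is at least the product of the individual probabilities. Measured in units of \<open>t\<^sub>i\<^sub>j\<close>, the
  capacity bound \<open>\<lfloor>c\<^sub>j\<rfloor>\<close> and all \<open>t\<close>-sizes counted in \<open>E\<^sub>i\<^sub>j\<close> are integers; since \<open>i\<close> itself has size one,
  on \<open>E\<^sub>i\<^sub>j\<close> the items other than \<open>i\<close> already have total size at least \<open>\<lfloor>c\<^sub>j\<rfloor>\<close>. The expected total size is
  at most \<open>2 c\<^sub>j / \<alpha>\<close>, because rounding at most doubles the sizes. The Chernoff bound with base \<open>e q\<close>,
  where \<open>q = (\<lfloor>B\<rfloor> k)\<^bsup>1/\<lfloor>B\<rfloor>\<^esup>\<close>, then bounds the probability of \<open>E\<^sub>i\<^sub>j\<close> by \<open>q\<close> to the power \<open>-\<lfloor>c\<^sub>j\<rfloor>\<close>, which is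
  at most \<open>1 / (k \<lfloor>B\<rfloor>)\<close>.
\<close>

context prob_space
begin

lemma indep_vars_of_indep_events:
  assumes "indep_events (\<lambda>i. {\<omega> \<in> space M. P i \<omega>}) I" (is "indep_events ?F I")
  shows "indep_vars (\<lambda>_. count_space UNIV) P I"
  unfolding indep_vars_def2
proof (intro conjI ballI)
  fix i assume "i \<in> I"
  then have "?F i \<in> events"
    using assms unfolding indep_events_def by blast
  then show "random_variable (count_space UNIV) (P i)"
    by (simp add: pred_def)
next
  have "indep_sets (\<lambda>i. sigma_sets (space M) {?F i}) I"
    using assms unfolding indep_events_def_alt
    by (intro indep_sets_sigma) (auto simp: Int_stable_def)
  then show "indep_sets (\<lambda>i. {P i -` A \<inter> space M |A. A \<in> sets (count_space UNIV)}) I"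
  proof (rule indep_sets_mono_sets)
    fix i
    have "P i -` A \<inter> space M \<in> sigma_sets (space M) {?F i}" for A
    proof -
      have "P i \<omega> \<in> A \<longleftrightarrow> (if P i \<omega> then True \<in> A else False \<in> A)" for \<omega>
        by (cases "P i \<omega>") simp_all
      then have "P i -` A \<inter> space M = {\<omega> \<in> space M. if P i \<omega> then True \<in> A else False \<in> A}"
        by blast
      also have "\<dots> \<in> {{}, ?F i, space M - ?F i, space M}"
        by (cases "True \<in> A"; cases "False \<in> A") auto
      finally show ?thesis
        using sigma_sets_singleton[of "?F i" "space M"] by auto
    qed
    then show "{P i -` A \<inter> space M |A. A \<in> sets (count_space UNIV)} \<subseteq> sigma_sets (space M) {?F i}"
      by blast
  qed
qed

lemma prob_eq_expectation_of_bool: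
  assumes "{\<omega> \<in> space M. P \<omega>} \<in> events"
  shows "\<P>(\<omega> in M. P \<omega>) = expectation (\<lambda>\<omega>. of_bool (P \<omega>))"
proof -
  have "expectation (\<lambda>\<omega>. of_bool (P \<omega>)) = expectation (indicator {\<omega> \<in> space M. P \<omega>})"
    by (intro Bochner_Integration.integral_cong) auto
  also have "\<dots> = \<P>(\<omega> in M. P \<omega>)"
    using assms by (subst Bochner_Integration.integral_indicator) auto
  finally show ?thesis ..
qed

lemma
  fixes X :: "'a \<Rightarrow> real"
  assumes "random_variable borel X" and "AE \<omega> in M. X \<omega> \<in> {0..1}"
  shows expectation_exp_le_unit_interval:
      "expectation (\<lambda>\<omega>. exp (s * X \<omega>)) \<le> exp ((exp s - 1) * expectation X)"
    and integrable_exp_unit_interval: "integrable M (\<lambda>\<omega>. exp (s * X \<omega>))"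
proof -
  interpret interval_bounded_random_variable M X 0 1
    by unfold_locales (use assms in auto)
  have exp_le_chord: "AE \<omega> in M. exp (s * X \<omega>) \<le> 1 + (exp s - 1) * X \<omega>"
    using AE_in_interval
  proof eventually_elim
    case (elim \<omega>)
    then have "exp s powr X \<omega> * 1 powr (1 - X \<omega>) \<le> X \<omega> * exp s + (1 - X \<omega>) * 1"
      by (intro Youngs_inequality_0) auto
    then show ?case
      by (simp add: powr_def algebra_simps)
  qed
  have int_chord: "integrable M (\<lambda>\<omega>. 1 + (exp s - 1) * X \<omega>)"
    by (intro Bochner_Integration.integrable_add integrable_mult_right integrable integrable_const)
  show int_exp: "integrable M (\<lambda>\<omega>. exp (s * X \<omega>))"
  proof (rule Bochner_Integration.integrable_bound)
    show "AE \<omega> in M. norm (exp (s * X \<omega>)) \<le> norm (1 + (exp s - 1) * X \<omega>)"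
      using exp_le_chord by eventually_elim simp
  qed (use int_chord in auto)
  have "expectation (\<lambda>\<omega>. exp (s * X \<omega>)) \<le> expectation (\<lambda>\<omega>. 1 + (exp s - 1) * X \<omega>)"
    by (intro integral_mono_AE int_exp int_chord exp_le_chord)
  also have "\<dots> = 1 + (exp s - 1) * expectation X"
    using integrable by (simp add: prob_space)
  also have "\<dots> \<le> exp ((exp s - 1) * expectation X)"
    by (rule exp_ge_add_one_self)
  finally show "expectation (\<lambda>\<omega>. exp (s * X \<omega>)) \<le> exp ((exp s - 1) * expectation X)" .
qed

lemma chernoff_bound_unit_interval:
  fixes X :: "'i \<Rightarrow> 'a \<Rightarrow> real"
  assumes "finite I" and indep: "indep_vars (\<lambda>_. borel) X I"
    and unit: "\<And>i. i \<in> I \<Longrightarrow> AE \<omega> in M. X i \<omega> \<in> {0..1}" and "s > 0"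
  shows "\<P>(\<omega> in M. a \<le> (\<Sum>i\<in>I. X i \<omega>))
    \<le> exp ((exp s - 1) * (\<Sum>i\<in>I. expectation (X i)) - s * a)"
proof -
  let ?Z = "\<lambda>i \<omega>. exp (s * X i \<omega>)"
  have measurable_X: "random_variable borel (X i)" if "i \<in> I" for i
    using indep that unfolding indep_vars_def by blast
  have indep_Z: "indep_vars (\<lambda>_. borel) ?Z I"
    by (rule indep_vars_compose2[OF indep]) auto
  have int_Z: "integrable M (?Z i)" if "i \<in> I" for i
    by (rule integrable_exp_unit_interval[OF measurable_X[OF that] unit[OF that]])
  have exp_sum_eq: "exp (s * (\<Sum>i\<in>I. X i \<omega>)) = (\<Prod>i\<in>I. ?Z i \<omega>)" for \<omega>
    using \<open>finite I\<close> by (simp add: sum_distrib_left exp_sum)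
  have "integrable M (\<lambda>\<omega>. exp (s * (\<Sum>i\<in>I. X i \<omega>)))"
    unfolding exp_sum_eq by (rule indep_vars_integrable[OF \<open>finite I\<close> indep_Z int_Z])
  moreover from this have "set_integrable M (space M) (\<lambda>\<omega>. exp (s * (\<Sum>i\<in>I. X i \<omega>)))"
    unfolding set_integrable_def by (intro integrable_mult_indicator) auto
  ultimately have "\<P>(\<omega> in M. a \<le> (\<Sum>i\<in>I. X i \<omega>))
      \<le> exp (- s * a) * expectation (\<lambda>\<omega>. exp (s * (\<Sum>i\<in>I. X i \<omega>)))"
    using Chernoff_ineq_ge[OF \<open>s > 0\<close>, of "space M" "\<lambda>\<omega>. \<Sum>i\<in>I. X i \<omega>" a]
    by (simp add: set_integral_space)
  also have "expectation (\<lambda>\<omega>. exp (s * (\<Sum>i\<in>I. X i \<omega>))) = (\<Prod>i\<in>I. expectation (?Z i))"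
    unfolding exp_sum_eq by (rule indep_vars_lebesgue_integral[OF \<open>finite I\<close> indep_Z int_Z])
  also have "\<dots> \<le> (\<Prod>i\<in>I. exp ((exp s - 1) * expectation (X i)))"
    using expectation_exp_le_unit_interval[OF measurable_X unit] by (intro prod_mono) auto
  also have "\<dots> = exp ((exp s - 1) * (\<Sum>i\<in>I. expectation (X i)))"
    using \<open>finite I\<close> by (simp add: sum_distrib_left exp_sum)
  finally show ?thesis
    by (simp add: mult_left_mono flip: exp_add)
qed

end

locale indep_random_set = prob_space +
  fixes R :: "'a \<Rightarrow> 'i set"
  assumes indep_membership: "indep_events (\<lambda>i. {\<omega> \<in> space M. i \<in> R \<omega>}) UNIV"
begin

lemma indep_vars_membership: "indep_vars (\<lambda>_. count_space UNIV) (\<lambda>i \<omega>. i \<in> R \<omega>) UNIV"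
  by (rule indep_vars_of_indep_events[OF indep_membership])

lemma membership_event: "{\<omega> \<in> space M. i \<in> R \<omega>} \<in> events"
  using indep_membership unfolding indep_events_def by blast

lemma measurable_R_Int [measurable]:
  assumes "finite I"
  shows "(\<lambda>\<omega>. R \<omega> \<inter> I) \<in> measurable M (count_space UNIV)"
proof -
  have "(\<lambda>\<omega>. \<lambda>i\<in>I. i \<in> R \<omega>) \<in> measurable M (Pi\<^sub>M I (\<lambda>_. count_space UNIV))"
    using indep_vars_membership unfolding indep_vars_def by (intro measurable_restrict) auto
  then have "(\<lambda>\<omega>. {i \<in> I. (\<lambda>i\<in>I. i \<in> R \<omega>) i}) \<in> measurable M (count_space UNIV)"
    by (rule measurable_compose) (simp add: count_space_PiM_finite assms)
  moreover have "{i \<in> I. (\<lambda>i\<in>I. i \<in> R \<omega>) i} = R \<omega> \<inter> I" for \<omega>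
    by auto
  ultimately show ?thesis
    by simp
qed

lemma integrable_R_Int:
  fixes f :: "'i set \<Rightarrow> real"
  assumes "finite I"
  shows "integrable M (\<lambda>\<omega>. f (R \<omega> \<inter> I))"
proof (rule integrable_const_bound)
  show "AE \<omega> in M. norm (f (R \<omega> \<inter> I)) \<le> (\<Sum>A\<in>Pow I. norm (f A))"
    using assms by (intro always_eventually allI member_le_sum) auto
  show "(\<lambda>\<omega>. f (R \<omega> \<inter> I)) \<in> borel_measurable M"
    using measurable_compose[OF measurable_R_Int[OF assms], of f borel] by simp
qed

lemma prob_eq_expectation_R_Int:
  assumes "finite I"
  shows "\<P>(\<omega> in M. Q (R \<omega> \<inter> I)) = expectation (\<lambda>\<omega>. of_bool (Q (R \<omega> \<inter> I)))"
  using measurable_sets[OF measurable_R_Int[OF assms], of "{A. Q A}"]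
  by (intro prob_eq_expectation_of_bool) (simp add: vimage_def Int_def conj_commute)

lemma expectation_membership_mult_R_Int:
  fixes g :: "bool \<Rightarrow> real" and f :: "'i set \<Rightarrow> real"
  assumes "finite I" "i \<notin> I"
  shows "expectation (\<lambda>\<omega>. g (i \<in> R \<omega>) * f (R \<omega> \<inter> I))
    = expectation (\<lambda>\<omega>. g (i \<in> R \<omega>)) * expectation (\<lambda>\<omega>. f (R \<omega> \<inter> I))"
proof (rule indep_var_lebesgue_integral)
  have "indep_var
      borel ((\<lambda>X. g (X i)) \<circ> (\<lambda>\<omega>. \<lambda>i\<in>{i}. i \<in> R \<omega>))
      borel ((\<lambda>X. f {i \<in> I. X i}) \<circ> (\<lambda>\<omega>. \<lambda>i\<in>I. i \<in> R \<omega>))"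
    using assms
    by (intro indep_var_compose[OF indep_var_restrict[OF indep_vars_membership]])
      (simp_all add: count_space_PiM_finite)
  moreover have "(\<lambda>X. g (X i)) \<circ> (\<lambda>\<omega>. \<lambda>i\<in>{i}. i \<in> R \<omega>) = (\<lambda>\<omega>. g (i \<in> R \<omega>))"
    by auto
  moreover have "(\<lambda>X. f {i \<in> I. X i}) \<circ> (\<lambda>\<omega>. \<lambda>i\<in>I. i \<in> R \<omega>) = (\<lambda>\<omega>. f (R \<omega> \<inter> I))"
    by (auto intro!: arg_cong[where f = f])
  ultimately show "indep_var borel (\<lambda>\<omega>. g (i \<in> R \<omega>)) borel (\<lambda>\<omega>. f (R \<omega> \<inter> I))"
    by simp
  show "integrable M (\<lambda>\<omega>. g (i \<in> R \<omega>))"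
    using integrable_R_Int[of "{i}" "\<lambda>A. g (i \<in> A)"] by simp
qed (rule integrable_R_Int[OF assms(1)])

lemma expectation_R_Int_insert:
  fixes f :: "'i set \<Rightarrow> real" and i :: 'i
  defines "p \<equiv> \<P>(\<omega> in M. i \<in> R \<omega>)"
  assumes "finite I" "i \<notin> I"
  shows "expectation (\<lambda>\<omega>. f (R \<omega> \<inter> insert i I))
    = p * expectation (\<lambda>\<omega>. f (insert i (R \<omega> \<inter> I))) + (1 - p) * expectation (\<lambda>\<omega>. f (R \<omega> \<inter> I))"
proof -
  let ?X = "\<lambda>\<omega>. of_bool (i \<in> R \<omega>) :: real"
  have p_eq: "p = expectation ?X"
    unfolding p_def by (rule prob_eq_expectation_of_bool[OF membership_event])
  have int_X: "integrable M ?X"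
    using integrable_R_Int[of "{i}" "\<lambda>A. of_bool (i \<in> A)"] by simp
  have int_mult: "integrable M (\<lambda>\<omega>. g (i \<in> R \<omega>) * h (R \<omega> \<inter> I))"
    for g :: "bool \<Rightarrow> real" and h
    using integrable_R_Int[of "insert i I" "\<lambda>A. g (i \<in> A) * h (A \<inter> I)"] assms(2,3)
    by (simp add: Int_assoc Int_absorb1 subset_insertI)
  have "f (R \<omega> \<inter> insert i I) = ?X \<omega> * f (insert i (R \<omega> \<inter> I)) + (1 - ?X \<omega>) * f (R \<omega> \<inter> I)" for \<omega>
    by (simp add: Int_insert_right)
  then have "expectation (\<lambda>\<omega>. f (R \<omega> \<inter> insert i I))
      = expectation (\<lambda>\<omega>. ?X \<omega> * f (insert i (R \<omega> \<inter> I)) + (1 - ?X \<omega>) * f (R \<omega> \<inter> I))"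
    by presburger
  also have "\<dots> = expectation (\<lambda>\<omega>. ?X \<omega> * f (insert i (R \<omega> \<inter> I)))
      + expectation (\<lambda>\<omega>. (1 - ?X \<omega>) * f (R \<omega> \<inter> I))"
    by (intro Bochner_Integration.integral_add int_mult[of of_bool]
        int_mult[of "\<lambda>b. 1 - of_bool b"])
  also have "expectation (\<lambda>\<omega>. ?X \<omega> * f (insert i (R \<omega> \<inter> I)))
      = p * expectation (\<lambda>\<omega>. f (insert i (R \<omega> \<inter> I)))"
    unfolding p_eq by (rule expectation_membership_mult_R_Int[OF assms(2,3)])
  also have "expectation (\<lambda>\<omega>. (1 - ?X \<omega>) * f (R \<omega> \<inter> I))
      = (1 - p) * expectation (\<lambda>\<omega>. f (R \<omega> \<inter> I))"
    using expectation_membership_mult_R_Int[OF assms(2,3), of "\<lambda>b. 1 - of_bool b"] int_X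
    by (simp add: p_eq prob_space)
  finally show ?thesis .
qed

lemma harris_inequality:
  fixes f g :: "'i set \<Rightarrow> real"
  assumes "finite I" "antimono f" "antimono g"
  shows "expectation (\<lambda>\<omega>. f (R \<omega> \<inter> I)) * expectation (\<lambda>\<omega>. g (R \<omega> \<inter> I))
    \<le> expectation (\<lambda>\<omega>. f (R \<omega> \<inter> I) * g (R \<omega> \<inter> I))"
  using assms
proof (induction I arbitrary: f g)
  case empty
  then show ?case
    by (simp add: prob_space)
next
  case (insert i I)
  define p where "p = \<P>(\<omega> in M. i \<in> R \<omega>)"
  let ?E = "\<lambda>h. expectation (\<lambda>\<omega>. h (R \<omega> \<inter> I))"
  let ?f = "\<lambda>A. f (insert i A)" and ?g = "\<lambda>A. g (insert i A)"
  have expectation_insert: "expectation (\<lambda>\<omega>. h (R \<omega> \<inter> insert i I))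
      = p * ?E (\<lambda>A. h (insert i A)) + (1 - p) * ?E h" for h :: "'i set \<Rightarrow> real"
    unfolding p_def by (rule expectation_R_Int_insert[OF insert.hyps])
  have p_bounds: "0 \<le> p" "0 \<le> 1 - p"
    by (simp_all add: p_def)
  have antimono_insert: "antimono (\<lambda>A. h (insert i A))" if "antimono h" for h :: "'i set \<Rightarrow> real"
    by (intro antimonoI antimonoD[OF that] Set.insert_mono)
  have expectation_insert_le: "?E (\<lambda>A. h (insert i A)) \<le> ?E h"
    if "antimono h" for h :: "'i set \<Rightarrow> real"
    by (intro integral_mono integrable_R_Int insert.hyps antimonoD[OF that] subset_insertI
        integrable_R_Int[where f = "\<lambda>A. h (insert i A)"])
  have "0 \<le> p * (1 - p) * ((?E f - ?E ?f) * (?E g - ?E ?g))"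
    using p_bounds expectation_insert_le insert.prems by (intro mult_nonneg_nonneg) auto
  then have "(p * ?E ?f + (1 - p) * ?E f) * (p * ?E ?g + (1 - p) * ?E g)
      \<le> p * (?E ?f * ?E ?g) + (1 - p) * (?E f * ?E g)"
    by (simp add: algebra_simps)
  also have "\<dots> \<le> p * ?E (\<lambda>A. ?f A * ?g A) + (1 - p) * ?E (\<lambda>A. f A * g A)"
    using p_bounds antimono_insert insert.prems by (intro add_mono mult_left_mono insert.IH) auto
  finally show ?case
    unfolding expectation_insert[of f] expectation_insert[of g]
      expectation_insert[of "\<lambda>A. f A * g A"] .
qed

lemma prod_prob_le_prob_Ball_antimono:
  assumes "finite I" "finite J" "\<And>j. j \<in> J \<Longrightarrow> antimono (Q j)"
  shows "(\<Prod>j\<in>J. \<P>(\<omega> in M. Q j (R \<omega> \<inter> I))) \<le> \<P>(\<omega> in M. \<forall>j\<in>J. Q j (R \<omega> \<inter> I))"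
  using assms(2,3)
proof (induction J)
  case empty
  then show ?case
    by (simp add: prob_space)
next
  case (insert j J)
  let ?E = "\<lambda>P. expectation (\<lambda>\<omega>. of_bool (P (R \<omega> \<inter> I)))"
  let ?All = "\<lambda>A. \<forall>j\<in>J. Q j A"
  have "antimono (\<lambda>A. of_bool (Q j A) :: real)" "antimono (\<lambda>A. of_bool (?All A) :: real)"
    using insert.prems by (fastforce simp: monotone_def of_bool_def)+
  note harris = harris_inequality[OF assms(1) this]
  have "(\<Prod>j\<in>insert j J. \<P>(\<omega> in M. Q j (R \<omega> \<inter> I)))
      \<le> \<P>(\<omega> in M. Q j (R \<omega> \<inter> I)) * \<P>(\<omega> in M. ?All (R \<omega> \<inter> I))"
    using insert by (simp add: mult_left_mono)
  also have "\<dots> = ?E (Q j) * ?E ?All"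
    using prob_eq_expectation_R_Int[OF assms(1), of "Q j"]
      prob_eq_expectation_R_Int[OF assms(1), of ?All]
    by simp
  also have "\<dots> \<le> ?E (\<lambda>A. Q j A \<and> ?All A)"
    using harris by (simp flip: of_bool_conj)
  also have "\<dots> = \<P>(\<omega> in M. \<forall>j\<in>insert j J. Q j (R \<omega> \<inter> I))"
    using prob_eq_expectation_R_Int[OF assms(1), of "\<lambda>A. Q j A \<and> ?All A"] by simp
  finally show ?case .
qed

lemma cond_prob_membership:
  assumes "finite I" "i \<notin> I" "\<P>(\<omega> in M. i \<in> R \<omega>) \<noteq> 0"
  shows "cond_prob M (\<lambda>\<omega>. Q (R \<omega> \<inter> insert i I)) (\<lambda>\<omega>. i \<in> R \<omega>)
    = \<P>(\<omega> in M. Q (insert i (R \<omega> \<inter> I)))"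
proof -
  let ?Q = "\<lambda>A. Q (insert i A)"
  have "\<P>(\<omega> in M. Q (R \<omega> \<inter> insert i I) \<and> i \<in> R \<omega>)
      = expectation (\<lambda>\<omega>. of_bool (Q (R \<omega> \<inter> insert i I) \<and> i \<in> R \<omega>))"
    using prob_eq_expectation_R_Int[of "insert i I" "\<lambda>A. Q A \<and> i \<in> A"] assms(1) by simp
  also have "\<dots> = expectation (\<lambda>\<omega>. of_bool (i \<in> R \<omega>) * of_bool (?Q (R \<omega> \<inter> I)))"
    by (intro Bochner_Integration.integral_cong) (auto simp: Int_insert_right)
  also have "\<dots> = \<P>(\<omega> in M. i \<in> R \<omega>) * \<P>(\<omega> in M. ?Q (R \<omega> \<inter> I))"
    using expectation_membership_mult_R_Int[OF assms(1,2), of of_bool "\<lambda>A. of_bool (?Q A)"]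
      prob_eq_expectation_R_Int[OF assms(1), of ?Q] prob_eq_expectation_of_bool[OF membership_event]
    by simp
  finally show ?thesis
    using assms(3) by (simp add: cond_prob_def)
qed

lemma prob_sum_ge_le_powr:
  fixes t :: "'i \<Rightarrow> real"
  assumes "finite I" and weights: "\<And>i. i \<in> I \<Longrightarrow> 0 \<le> t i \<and> t i \<le> 1" and "1 \<le> q"
    and mean: "exp 1 * q * (\<Sum>i\<in>I. \<P>(\<omega> in M. i \<in> R \<omega>) * t i) \<le> a"
  shows "\<P>(\<omega> in M. a \<le> (\<Sum>i\<in>R \<omega> \<inter> I. t i)) \<le> q powr - a"
proof -
  let ?X = "\<lambda>i \<omega>. of_bool (i \<in> R \<omega>) * t i"
  define \<mu> where "\<mu> = (\<Sum>i\<in>I. \<P>(\<omega> in M. i \<in> R \<omega>) * t i)"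
  have exp_one_plus_ln: "exp (1 + ln q) = exp 1 * q"
    using \<open>1 \<le> q\<close> by (simp add: exp_add)
  have indep: "indep_vars (\<lambda>_. borel) ?X I"
    by (rule indep_vars_compose2[OF indep_vars_subset[OF indep_vars_membership subset_UNIV]]) simp
  have "expectation (?X i) = \<P>(\<omega> in M. i \<in> R \<omega>) * t i" for i
    by (simp add: prob_eq_expectation_of_bool[OF membership_event])
  then have sum_expectation_eq: "(\<Sum>i\<in>I. expectation (?X i)) = \<mu>"
    by (simp only: \<mu>_def)
  have "(\<Sum>i\<in>R \<omega> \<inter> I. t i) = (\<Sum>i\<in>I. ?X i \<omega>)" for \<omega>
    using \<open>finite I\<close> by (intro sum.mono_neutral_cong_left) auto
  then have "\<P>(\<omega> in M. a \<le> (\<Sum>i\<in>R \<omega> \<inter> I. t i)) = \<P>(\<omega> in M. a \<le> (\<Sum>i\<in>I. ?X i \<omega>))"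
    by simp
  also have "\<dots> \<le> exp ((exp 1 * q - 1) * \<mu> - (1 + ln q) * a)"
    using chernoff_bound_unit_interval[OF \<open>finite I\<close> indep, of "1 + ln q" a] weights \<open>1 \<le> q\<close>
    unfolding exp_one_plus_ln sum_expectation_eq by (auto simp: add_pos_nonneg)
  also have "\<dots> \<le> exp (- a * ln q)"
  proof -
    have "0 \<le> \<mu>"
      unfolding \<mu>_def using weights by (intro sum_nonneg) auto
    then show ?thesis
      using mean by (simp add: \<mu>_def algebra_simps)
  qed
  also have "\<dots> = q powr - a"
    using \<open>1 \<le> q\<close> by (simp add: powr_def)
  finally show ?thesis .
qed

end

lemma powr_inverse_powr_minus_le:
  fixes z b a :: real
  assumes "1 \<le> z" "0 < b" "b \<le> a"
  shows "(z powr (1 / b)) powr - a \<le> 1 / z"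
proof -
  have "(z powr (1 / b)) powr - a = z powr - (a / b)"
    by (simp add: powr_powr)
  also have "\<dots> \<le> z powr - 1"
    using assms by (intro powr_mono) auto
  finally show ?thesis
    using assms(1) by (simp add: powr_minus_divide)
qed

lemma le_inverse_power2_iff:
  fixes s :: real
  assumes "0 < s" "s \<le> 1"
  shows "s \<le> 1 / 2 ^ a \<longleftrightarrow> a \<le> nat \<lfloor>- log 2 s\<rfloor>"
proof -
  have "s \<le> 1 / 2 ^ a \<longleftrightarrow> log 2 s \<le> log 2 (1 / 2 ^ a)"
    using assms by (subst log_le_cancel_iff) auto
  also have "\<dots> \<longleftrightarrow> real a \<le> - log 2 s"
    by (auto simp: log_divide log_nat_power)
  also have "\<dots> \<longleftrightarrow> a \<le> nat \<lfloor>- log 2 s\<rfloor>"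
    using assms by (simp add: le_nat_iff le_floor_iff)
  finally show ?thesis .
qed

lemma pow2_ceil_eq:
  assumes "0 < s" "s \<le> 1"
  shows "pow2_ceil s = 1 / 2 ^ nat \<lfloor>- log 2 s\<rfloor>"
  unfolding pow2_ceil_def
proof (rule Least_equality)
  show "(\<exists>a. 1 / 2 ^ nat \<lfloor>- log 2 s\<rfloor> = (1::real) / 2 ^ a) \<and> s \<le> 1 / 2 ^ nat \<lfloor>- log 2 s\<rfloor>"
    using le_inverse_power2_iff[OF assms] by blast
next
  fix t :: real
  assume "(\<exists>a::nat. t = 1 / 2 ^ a) \<and> s \<le> t"
  then obtain a :: nat where "t = 1 / 2 ^ a" "a \<le> nat \<lfloor>- log 2 s\<rfloor>"
    using le_inverse_power2_iff[OF assms] by blast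
  then show "1 / 2 ^ nat \<lfloor>- log 2 s\<rfloor> \<le> t"
    by (simp add: frac_le power_increasing)
qed

lemma pow2_ceil_bounds:
  assumes "0 < s" "s \<le> 1"
  shows "0 < pow2_ceil s" "pow2_ceil s \<le> 1" "pow2_ceil s < 2 * s"
  using le_inverse_power2_iff[OF assms, of "Suc (nat \<lfloor>- log 2 s\<rfloor>)"]
  by (simp_all add: pow2_ceil_eq[OF assms] field_simps)

lemma pow2_ceil_1 [simp]: "pow2_ceil 1 = 1"
  by (simp add: pow2_ceil_eq)

lemma pow2_ceil_divide_Ints:
  assumes "0 < s" "s \<le> 1" "0 < s'" "s' \<le> 1" "pow2_ceil s \<le> pow2_ceil s'"
  shows "pow2_ceil s' / pow2_ceil s \<in> \<int>"
proof -
  obtain a b :: nat where ab: "pow2_ceil s = 1 / 2 ^ a" "pow2_ceil s' = 1 / 2 ^ b"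
    using pow2_ceil_eq assms by blast
  then have "(1::real) / 2 ^ a \<le> 1 / 2 ^ b"
    using assms(5) by simp
  then have "b \<le> a"
    by (simp add: field_simps)
  then have "pow2_ceil s' / pow2_ceil s = 2 ^ (a - b)"
    by (simp add: ab power_diff)
  then show ?thesis
    by simp
qed

lemma Ints_le_if_less_add_1:
  fixes x y :: "'a::linordered_idom"
  assumes "x \<in> \<int>" "y \<in> \<int>" "x < y + 1"
  shows "x \<le> y"
proof -
  obtain m n where "x = of_int m" "y = of_int n"
    using assms by (auto elim!: Ints_cases)
  moreover from this assms(3) have "of_int m < (of_int (n + 1) :: 'a)"
    by simp
  ultimately show ?thesis
    by (simp only: of_int_less_iff of_int_le_iff)
qed

definition rounded_size :: "real^'n^'m \<Rightarrow> 'm \<Rightarrow> 'n \<Rightarrow> real" where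
  "rounded_size S j i = (if S $ j $ i > 0 then pow2_ceil (S $ j $ i) else 0)"

lemma rounded_size_bounds:
  assumes "0 \<le> S $ j $ i" "S $ j $ i \<le> 1"
  shows "0 \<le> rounded_size S j i" "rounded_size S j i \<le> 1" "rounded_size S j i \<le> 2 * S $ j $ i"
  using pow2_ceil_bounds[of "S $ j $ i"] assms by (auto simp: rounded_size_def)

lemma sum_rounded_size_le:
  assumes "\<And>i. 0 \<le> S $ j $ i \<and> S $ j $ i \<le> 1" "\<And>i. 0 \<le> p i"
  shows "(\<Sum>i\<in>I. p i * rounded_size S j i) \<le> 2 * (\<Sum>i\<in>UNIV. S $ j $ i * p i)"
proof -
  have "(\<Sum>i\<in>I. p i * rounded_size S j i) \<le> (\<Sum>i\<in>UNIV. p i * rounded_size S j i)"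
    using rounded_size_bounds(1) assms by (intro sum_mono2 mult_nonneg_nonneg) auto
  also have "\<dots> \<le> (\<Sum>i\<in>UNIV. p i * (2 * S $ j $ i))"
    using rounded_size_bounds(3) assms by (intro sum_mono mult_left_mono) auto
  also have "\<dots> = 2 * (\<Sum>i\<in>UNIV. S $ j $ i * p i)"
    by (simp add: sum_distrib_left mult_ac)
  finally show ?thesis .
qed

lemma overflow_mono:
  assumes "\<And>i. S $ j $ i \<le> 1" "A \<subseteq> A'" "overflow S c A i j"
  shows "overflow S c A' i j"
proof -
  let ?G = "\<lambda>A. {i' \<in> A. S $ j $ i' > 0 \<and> pow2_ceil (S $ j $ i') \<ge> pow2_ceil (S $ j $ i)}"
  have "(\<Sum>i'\<in>?G A. pow2_ceil (S $ j $ i')) \<le> (\<Sum>i'\<in>?G A'. pow2_ceil (S $ j $ i'))"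
    using assms(1,2) pow2_ceil_bounds(1) by (intro sum_mono2) (auto intro: less_imp_le)
  then show ?thesis
    using assms(3) unfolding overflow_def by linarith
qed

lemma overflow_insert_imp_floor_le:
  fixes S :: "real^'n^'m"
  assumes sizes: "\<And>i. 0 \<le> S $ j $ i \<and> S $ j $ i \<le> 1" and "S $ j $ i > 0" "i \<notin> A"
    and "overflow S c (insert i A) i j"
  shows "\<lfloor>c $ j\<rfloor> \<le> (\<Sum>i'\<in>A. rounded_size S j i')"
proof -
  let ?t = "\<lambda>i'. pow2_ceil (S $ j $ i')"
  define G where "G = {i' \<in> A. S $ j $ i' > 0 \<and> ?t i \<le> ?t i'}"
  have t_pos: "0 < ?t i"
    using assms(2) sizes by (intro pow2_ceil_bounds) auto
  have "{i' \<in> insert i A. S $ j $ i' > 0 \<and> ?t i \<le> ?t i'} = insert i G" "i \<notin> G"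
    using assms(2,3) by (auto simp: G_def)
  then have "c $ j < ?t i + (\<Sum>i'\<in>G. ?t i')"
    using assms(4) unfolding overflow_def by simp
  then have "\<lfloor>c $ j\<rfloor> < ?t i + (\<Sum>i'\<in>G. ?t i')"
    by linarith
  then have unit_less: "\<lfloor>c $ j\<rfloor> / ?t i < (\<Sum>i'\<in>G. ?t i') / ?t i + 1"
    using t_pos by (simp add: field_simps)
  have "1 / ?t i \<in> \<int>"
    using pow2_ceil_divide_Ints[of "S $ j $ i" 1] pow2_ceil_bounds(2) assms(2) sizes by simp
  then have "\<lfloor>c $ j\<rfloor> * (1 / ?t i) \<in> \<int>"
    by (intro Ints_mult) auto
  moreover have "(\<Sum>i'\<in>G. ?t i' / ?t i) \<in> \<int>"
    using assms(2) sizes by (intro Ints_sum pow2_ceil_divide_Ints) (auto simp: G_def)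
  ultimately have "\<lfloor>c $ j\<rfloor> / ?t i \<le> (\<Sum>i'\<in>G. ?t i') / ?t i"
    using unit_less by (intro Ints_le_if_less_add_1) (simp_all add: sum_divide_distrib)
  then have "\<lfloor>c $ j\<rfloor> \<le> (\<Sum>i'\<in>G. ?t i')"
    using t_pos by (simp add: divide_le_cancel)
  also have "\<dots> = (\<Sum>i'\<in>G. rounded_size S j i')"
    by (intro sum.cong) (auto simp: G_def rounded_size_def)
  also have "\<dots> \<le> (\<Sum>i'\<in>A. rounded_size S j i')"
    using sizes by (intro sum_mono2 rounded_size_bounds) (auto simp: G_def)
  finally show ?thesis .
qed

lemma prob_overflow_le:
  fixes S :: "real^'n^'m"
  assumes "indep_random_set M R"
    and sizes: "\<And>i. 0 \<le> S $ j $ i \<and> S $ j $ i \<le> 1" and "S $ j $ i > 0"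
    and "1 \<le> c $ j" "1 \<le> q"
    and load: "(\<Sum>i\<in>UNIV. S $ j $ i * \<P>(\<omega> in M. i \<in> R \<omega>)) \<le> c $ j / (4 * exp 1 * q)"
  shows "\<P>(\<omega> in M. overflow S c (insert i (R \<omega>)) i j) \<le> q powr - real_of_int \<lfloor>c $ j\<rfloor>"
proof -
  interpret indep_random_set M R by fact
  let ?p = "\<lambda>i. \<P>(\<omega> in M. i \<in> R \<omega>)" and ?t = "rounded_size S j"
  have "(\<Sum>i'\<in>-{i}. ?p i' * ?t i') \<le> 2 * (\<Sum>i'\<in>UNIV. S $ j $ i' * ?p i')"
    by (intro sum_rounded_size_le sizes measure_nonneg)
  also have "\<dots> \<le> 2 * (c $ j / (4 * exp 1 * q))"
    by (intro mult_left_mono load) simp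
  also have "\<dots> \<le> \<lfloor>c $ j\<rfloor> / (exp 1 * q)"
  proof -
    have "1 \<le> \<lfloor>c $ j\<rfloor>"
      using \<open>1 \<le> c $ j\<close> by simp
    then have "c $ j \<le> 2 * real_of_int \<lfloor>c $ j\<rfloor>"
      by linarith
    then show ?thesis
      using \<open>1 \<le> q\<close> by (simp add: field_simps)
  qed
  finally have mean: "exp 1 * q * (\<Sum>i'\<in>-{i}. ?p i' * ?t i') \<le> \<lfloor>c $ j\<rfloor>"
    using \<open>1 \<le> q\<close> by (simp add: field_simps)
  have "\<P>(\<omega> in M. overflow S c (insert i (R \<omega>)) i j)
      \<le> \<P>(\<omega> in M. \<lfloor>c $ j\<rfloor> \<le> (\<Sum>i'\<in>R \<omega> \<inter> -{i}. ?t i'))"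
  proof (rule finite_measure_mono)
    show "{\<omega> \<in> space M. overflow S c (insert i (R \<omega>)) i j}
        \<subseteq> {\<omega> \<in> space M. \<lfloor>c $ j\<rfloor> \<le> (\<Sum>i'\<in>R \<omega> \<inter> -{i}. ?t i')}"
    proof safe
      fix \<omega> assume "overflow S c (insert i (R \<omega>)) i j"
      moreover have "insert i (R \<omega>) = insert i (R \<omega> \<inter> -{i})"
        by auto
      ultimately show "\<lfloor>c $ j\<rfloor> \<le> (\<Sum>i'\<in>R \<omega> \<inter> -{i}. ?t i')"
        using assms(3) sizes by (intro overflow_insert_imp_floor_le) auto
    qed
    show "{\<omega> \<in> space M. \<lfloor>c $ j\<rfloor> \<le> (\<Sum>i'\<in>R \<omega> \<inter> -{i}. ?t i')} \<in> events"
      by measurable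
  qed
  also have "\<dots> \<le> q powr - real_of_int \<lfloor>c $ j\<rfloor>"
    by (intro prob_sum_ge_le_powr conjI rounded_size_bounds) (use sizes \<open>1 \<le> q\<close> mean in auto)
  finally show ?thesis .
qed

lemma cond_prob_altered_ge:
  fixes S :: "real^'n^'m"
  assumes "indep_random_set M R" and "\<P>(\<omega> in M. i \<in> R \<omega>) \<noteq> 0"
    and sizes: "\<And>j i. S $ j $ i \<le> 1" and "card {j. S $ j $ i > 0} \<le> k" and "0 \<le> \<epsilon>" "\<epsilon> \<le> 1"
    and overflow_le: "\<And>j. S $ j $ i > 0 \<Longrightarrow> \<P>(\<omega> in M. overflow S c (insert i (R \<omega>)) i j) \<le> \<epsilon>"
  shows "(1 - \<epsilon>) ^ k \<le> cond_prob M (\<lambda>\<omega>. i \<in> altered S c (R \<omega>)) (\<lambda>\<omega>. i \<in> R \<omega>)"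
proof -
  interpret indep_random_set M R by fact
  define J where "J = {j. S $ j $ i > 0}"
  let ?Q = "\<lambda>j A. \<not> overflow S c (insert i A) i j"
  have "antimono (?Q j)" for j
    using overflow_mono[OF sizes Set.insert_mono] by (intro antimonoI) auto
  note harris = prod_prob_le_prob_Ball_antimono[where I = UNIV and J = J, OF _ _ this]
  have "(1 - \<epsilon>) ^ k \<le> (\<Prod>j\<in>J. 1 - \<epsilon>)"
    using assms(4-6) by (simp add: J_def power_decreasing)
  also have "\<dots> \<le> (\<Prod>j\<in>J. \<P>(\<omega> in M. ?Q j (R \<omega>)))"
  proof (intro prod_mono conjI)
    fix j assume "j \<in> J"
    have "{\<omega> \<in> space M. overflow S c (insert i (R \<omega> \<inter> UNIV)) i j} \<in> events"
      by measurable
    then have "\<P>(\<omega> in M. ?Q j (R \<omega>)) = 1 - \<P>(\<omega> in M. overflow S c (insert i (R \<omega>)) i j)"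
      by (intro prob_neg) simp
    then show "1 - \<epsilon> \<le> \<P>(\<omega> in M. ?Q j (R \<omega>))"
      using overflow_le[of j] \<open>j \<in> J\<close> by (simp add: J_def)
  qed (use \<open>\<epsilon> \<le> 1\<close> in simp)
  also have "\<dots> \<le> \<P>(\<omega> in M. \<forall>j\<in>J. ?Q j (R \<omega>))"
    using harris by simp
  also have "\<dots> = \<P>(\<omega> in M. i \<in> altered S c (insert i (R \<omega> \<inter> -{i})))"
    by (simp add: altered_def J_def insert_Diff_if flip: Diff_eq)
  also have "\<dots> = cond_prob M (\<lambda>\<omega>. i \<in> altered S c (R \<omega>)) (\<lambda>\<omega>. i \<in> R \<omega>)"
  proof -
    have "insert i (-{i}) = UNIV"
      by auto
    then show ?thesis
      using cond_prob_membership[of "-{i}" i "\<lambda>A. i \<in> altered S c A"] assms(2) by simp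
  qed
  finally show ?thesis .
qed

lemma cond_prob_altered_ge_of_scaled_load:
  fixes S :: "real^'n^'m" and b :: int
  assumes random_R: "indep_random_set M R" and "\<P>(\<omega> in M. i \<in> R \<omega>) \<noteq> 0"
    and sizes: "\<And>j i. 0 \<le> S $ j $ i \<and> S $ j $ i \<le> 1" and "card {j. S $ j $ i > 0} \<le> k"
    and "0 < k" "1 \<le> b" and capacity: "\<And>j. b \<le> c $ j"
    and load: "\<And>j. (\<Sum>i\<in>UNIV. S $ j $ i * \<P>(\<omega> in M. i \<in> R \<omega>))
      \<le> c $ j / (4 * exp 1 * (b * real k) powr (1 / b))"
  shows "(1 - 1 / (real k * b)) ^ k
    \<le> cond_prob M (\<lambda>\<omega>. i \<in> altered S c (R \<omega>)) (\<lambda>\<omega>. i \<in> R \<omega>)"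
  unfolding mult.commute[of "real k"]
proof (rule cond_prob_altered_ge[OF random_R])
  have bk_ge_1: "1 \<le> b * real k"
    using mult_mono[of 1 "real_of_int b" 1 "real k"] \<open>0 < k\<close> \<open>1 \<le> b\<close> by simp
  then show "0 \<le> 1 / (b * real k)" "1 / (b * real k) \<le> 1"
    by simp_all
  let ?q = "(b * real k) powr (1 / b)"
  fix j assume "S $ j $ i > 0"
  moreover have "1 \<le> c $ j"
    using capacity[of j] \<open>1 \<le> b\<close> by linarith
  moreover have "1 \<le> ?q"
    using bk_ge_1 \<open>1 \<le> b\<close> by (intro ge_one_powr_ge_zero) auto
  ultimately have "\<P>(\<omega> in M. overflow S c (insert i (R \<omega>)) i j) \<le> ?q powr - real_of_int \<lfloor>c $ j\<rfloor>"
    by (intro prob_overflow_le[OF random_R sizes] load)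
  also have "\<dots> \<le> 1 / (b * real k)"
    using bk_ge_1 \<open>1 \<le> b\<close> capacity[of j] by (intro powr_inverse_powr_minus_le)
      (auto simp: le_floor_iff)
  finally show "\<P>(\<omega> in M. overflow S c (insert i (R \<omega>)) i j) \<le> 1 / (b * real k)" .
qed (use assms(2,4) sizes in auto)

lemma rescaled_iff: "rescaled S \<longleftrightarrow> (\<forall>j. (\<exists>i. S $ j $ i = 1) \<and> (\<forall>i. S $ j $ i \<le> 1))"
proof -
  have "{S $ j $ i |i. S $ j $ i > 0} \<noteq> {} \<and> Max {S $ j $ i |i. S $ j $ i > 0} = 1
      \<longleftrightarrow> (\<exists>i. S $ j $ i = 1) \<and> (\<forall>i. S $ j $ i \<le> 1)" (is "?A \<noteq> {} \<and> _ \<longleftrightarrow> ?R") for j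
  proof -
    have "finite ?A"
      by simp
    then have "?A \<noteq> {} \<and> Max ?A = 1 \<longleftrightarrow> 1 \<in> ?A \<and> (\<forall>s\<in>?A. s \<le> 1)"
      using Max_eq_iff[of ?A 1] by blast
    also have "\<dots> \<longleftrightarrow> ?R"
      by (force simp: not_less)
    finally show ?thesis .
  qed
  then show ?thesis
    by (simp only: rescaled_def)
qed

lemma slack_eq_Min_capacity:
  fixes S :: "real^'n^'m"
  assumes "rescaled S" "0 \<le> c"
  shows "slack S c = Min (range (\<lambda>j. c $ j))"
  unfolding slack_def
proof (rule Min_eqI)
  have "{c $ j / S $ j $ i |i j. S $ j $ i > 0} \<subseteq> range (\<lambda>(i, j). c $ j / S $ j $ i)"
    by auto
  then show "finite {c $ j / S $ j $ i |i j. S $ j $ i > 0}"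
    by (rule finite_subset) simp
next
  fix v assume "v \<in> {c $ j / S $ j $ i |i j. S $ j $ i > 0}"
  then obtain i j where v_eq: "v = c $ j / S $ j $ i" "S $ j $ i > 0"
    by auto
  have "Min (range (\<lambda>j. c $ j)) \<le> c $ j / 1"
    by simp
  also have "\<dots> \<le> v"
    unfolding v_eq(1) using v_eq(2) assms
    by (intro divide_left_mono) (auto simp: rescaled_iff less_eq_vec_def)
  finally show "Min (range (\<lambda>j. c $ j)) \<le> v" .
next
  have "Min (range (\<lambda>j. c $ j)) \<in> range (\<lambda>j. c $ j)"
    by (intro Min_in) auto
  then obtain j where Min_eq: "Min (range (\<lambda>j. c $ j)) = c $ j"
    by blast
  obtain i where "S $ j $ i = 1"
    using assms(1) by (auto simp: rescaled_iff)
  then show "Min (range (\<lambda>j. c $ j)) \<in> {c $ j / S $ j $ i |i j. S $ j $ i > 0}"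
    unfolding Min_eq by (auto intro!: exI[of _ i] exI[of _ j])
qed

lemma k_cs_pip_card_le:
  assumes "k_cs_pip k w S c"
  shows "card {j. S $ j $ i > 0} \<le> k"
proof -
  have "card {j. S $ j $ i > 0} \<le> card {j. S $ j $ i \<noteq> 0}"
    by (intro card_mono) auto
  also have "\<dots> \<le> k"
    using assms by (simp add: k_cs_pip_def)
  finally show ?thesis .
qed

lemma k_cs_pip_rescaled_pos:
  assumes "k_cs_pip k w S c" "rescaled S"
  shows "0 < k"
proof -
  obtain j i where "S $ j $ i = 1"
    using assms(2) unfolding rescaled_iff by blast
  then have "j \<in> {j. S $ j $ i > 0}"
    by simp
  then have "0 < card {j. S $ j $ i > 0}"
    by (auto simp: card_gt_0_iff)
  also have "\<dots> \<le> k"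
    by (rule k_cs_pip_card_le[OF assms(1)])
  finally show ?thesis .
qed

lemma lp_optimal_scaled_load_le:
  assumes "lp_optimal w S c x" "0 < \<alpha>"
  shows "(\<Sum>i\<in>UNIV. S $ j $ i * (x $ i / \<alpha>)) \<le> c $ j / \<alpha>"
proof -
  have "(\<Sum>i\<in>UNIV. S $ j $ i * x $ i) \<le> c $ j"
    using assms(1) by (simp add: lp_optimal_def is_arg_max_def lp_feasible_def less_eq_vec_def
        matrix_vector_mult_def)
  then show ?thesis
    using assms(2) by (simp add: divide_right_mono flip: sum_divide_distrib)
qed

theorem theorem8:
  fixes k :: nat
    and w x :: "real^'n"
    and S :: "real^'n^'m"
    and c :: "real^'m"
    and B \<alpha> :: real
    and M :: "'a measure"
    and R :: "'a \<Rightarrow> 'n set"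
  assumes "k_cs_pip k w S c"
    and "\<forall>i j. S $ j $ i \<le> c $ j"
    and "rescaled S"
    and "B = Min (range (\<lambda>j. c $ j))"
    and "\<alpha> = 4 * exp 1 * (real_of_int \<lfloor>B\<rfloor> * real k) powr (1 / real_of_int \<lfloor>B\<rfloor>)"
    and "lp_optimal w S c x"
    and "prob_space M"
    and "prob_space.indep_events M (\<lambda>i. {\<omega> \<in> space M. i \<in> R \<omega>}) UNIV"
    and "\<forall>i. measure M {\<omega> \<in> space M. i \<in> R \<omega>} = x $ i / \<alpha>"
  shows "B \<ge> 1 \<and> B = slack S c \<and>
    (\<forall>i. x $ i > 0 \<longrightarrow>
      cond_prob M (\<lambda>\<omega>. i \<in> altered S c (R \<omega>)) (\<lambda>\<omega>. i \<in> R \<omega>)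
        \<ge> (1 - 1 / (real k * real_of_int \<lfloor>B\<rfloor>)) ^ k)"
proof (intro conjI allI impI)
  have sizes: "0 \<le> S $ j $ i \<and> S $ j $ i \<le> 1" for i j
    using assms(1,3) by (simp add: k_cs_pip_def rescaled_iff)
  have "1 \<le> c $ j" for j
    using assms(2,3) unfolding rescaled_iff by metis
  then show "1 \<le> B"
    unfolding assms(4) by simp
  then have B_floor: "1 \<le> \<lfloor>B\<rfloor>" by simp
  show "B = slack S c"
    using assms(1,3) by (simp add: assms(4) slack_eq_Min_capacity k_cs_pip_def)
  note k_pos = k_cs_pip_rescaled_pos[OF assms(1,3)]
  have alpha_pos: "0 < \<alpha>"
    using B_floor k_pos by (auto simp: assms(5) zero_less_mult_iff) linarith
  have load: "(\<Sum>i\<in>UNIV. S $ j $ i * \<P>(\<omega> in M. i \<in> R \<omega>)) \<le> c $ j / \<alpha>" for j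
    using lp_optimal_scaled_load_le[OF assms(6) alpha_pos] assms(9) by simp
  have capacity: "\<lfloor>B\<rfloor> \<le> c $ j" for j
    unfolding assms(4) by (rule order_trans[OF of_int_floor_le]) simp
  have random_R: "indep_random_set M R"
    using assms(7,8) by (intro indep_random_set.intro indep_random_set_axioms.intro)
  fix i assume "x $ i > 0"
  then have "\<P>(\<omega> in M. i \<in> R \<omega>) \<noteq> 0"
    using alpha_pos assms(9) by simp
  then show "(1 - 1 / (real k * \<lfloor>B\<rfloor>)) ^ k
      \<le> cond_prob M (\<lambda>\<omega>. i \<in> altered S c (R \<omega>)) (\<lambda>\<omega>. i \<in> R \<omega>)"
    by (rule cond_prob_altered_ge_of_scaled_load[OF random_R _ sizes k_cs_pip_card_le[OF assms(1)]
          k_pos B_floor capacity load[unfolded assms(5)]])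
qed

end
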